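(* Let $M18_{1}$ be the real Lie algebra with basis $x_1,\dots,x_6$ and nonzero brackets $[x_1,x_2]=x_3$, $[x_1,x_3]=x_4$, $[x_1,x_4]=x_6$, $[x_2,x_3]=x_5$, $[x_2,x_5]=x_6$. For $\epsilon\in\{1,-1\}$ let $$J(\epsilon)=\begin{pmatrix}0&-1&0&0&0&0\\1&0&0&0&0&0\\0&0&0&0&0&\epsilon\\0&0&0&0&-1&0\\0&0&0&1&0&0\\0&0&-\frac1\epsilon&0&0&0\end{pmatrix}.$$ Then every complex structure on $M18_1$ is equivalent to $J(1)$ or to $J(-1)$, and $J(1)$, $J(-1)$ are not equivalent; thus the set $\mathfrak{X}_{M18_1}$ of all complex structures on $M18_1$ consists of exactly two $\mathrm{Aut}(M18_1)$-orbits. Moreover $\mathfrak{X}_{M18_1}$ is a submanifold of dimension 8 of $\mathbb{R}^{36}$.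
   Context: Brackets of basis vectors not listed (and not obtained by antisymmetry) are zero. A complex structure on a real Lie algebra $\mathfrak{g}$ is a linear map $J:\mathfrak{g}\to\mathfrak{g}$ with $J^2=-1$ and $[JX,JY]-[X,Y]-J[JX,Y]-J[X,JY]=0$ for all $X,Y\in\mathfrak{g}$. $J$ is identified with its $6\times 6$ matrix $(\xi^k_j)$ ($k$ the row index, $j$ the column index) in the basis $(x_j)$, i.e. $Jx_j=\sum_k\xi^k_j x_k$; so the set of complex structures is a subset of $\mathbb{R}^{36}$. "Submanifold" means smooth ($C^\infty$) submanifold. $\mathrm{Aut}(\mathfrak{g})$ acts on complex structures by $J\mapsto\Phi^{-1}J\Phi$, and two complex structures are equivalent if they lie in the same orbit. *)

theory Defs
  imports "HOL-Analysis.Analysis"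
begin

section \<open>Smooth maps and submanifolds of Euclidean space\<close>

text \<open>Meaningful for open \<open>U\<close>: the derivative at \<open>x\<close> is taken in the ambient space.\<close>

primrec Ck_on :: "nat \<Rightarrow> ('a::euclidean_space \<Rightarrow> 'b::euclidean_space) \<Rightarrow> 'a set \<Rightarrow> bool" where
  "Ck_on 0 f U \<longleftrightarrow> continuous_on U f"
| "Ck_on (Suc k) f U \<longleftrightarrow>
     (\<forall>x\<in>U. f differentiable (at x)) \<and>
     (\<forall>v. Ck_on k (\<lambda>x. frechet_derivative f (at x) v) U)"

definition smooth_on :: "'a::euclidean_space set \<Rightarrow> ('a \<Rightarrow> 'b::euclidean_space) \<Rightarrow> bool" where
  "smooth_on U f \<longleftrightarrow> (\<forall>k. Ck_on k f U)"

definition diffeomorphism :: "'a::euclidean_space set \<Rightarrow> 'b::euclidean_space set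
    \<Rightarrow> ('a \<Rightarrow> 'b) \<Rightarrow> ('b \<Rightarrow> 'a) \<Rightarrow> bool" where
  "diffeomorphism U V \<phi> \<psi> \<longleftrightarrow>
     open U \<and> open V \<and> homeomorphism U V \<phi> \<psi> \<and> smooth_on U \<phi> \<and> smooth_on V \<psi>"

text \<open>Embedded submanifold: locally, a diffeomorphism of the ambient space flattens \<open>S\<close>
  onto a \<open>d\<close>-dimensional linear subspace.\<close>

definition submanifold :: "nat \<Rightarrow> 'a::euclidean_space set \<Rightarrow> bool" where
  "submanifold d S \<longleftrightarrow>
     (\<forall>p\<in>S. \<exists>U V (\<phi> :: 'a \<Rightarrow> 'a) \<psi> L.
        p \<in> U \<and> diffeomorphism U V \<phi> \<psi> \<and> subspace L \<and> dim L = d \<and> \<phi> ` (U \<inter> S) = V \<inter> L)"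


section \<open>Complex structures on Lie algebras\<close>

definition lie_bracket :: "('a::real_vector \<Rightarrow> 'a \<Rightarrow> 'a) \<Rightarrow> bool" where
  "lie_bracket br \<longleftrightarrow>
     bilinear br \<and> (\<forall>x. br x x = 0) \<and>
     (\<forall>x y z. br x (br y z) + br y (br z x) + br z (br x y) = 0)"

definition complex_structure :: "('a::real_vector \<Rightarrow> 'a \<Rightarrow> 'a) \<Rightarrow> ('a \<Rightarrow> 'a) \<Rightarrow> bool" where
  "complex_structure br J \<longleftrightarrow>
     linear J \<and> (\<forall>x. J (J x) = - x) \<and>
     (\<forall>x y. br (J x) (J y) - br x y - J (br (J x) y) - J (br x (J y)) = 0)"

definition Aut :: "('a::real_vector \<Rightarrow> 'a \<Rightarrow> 'a) \<Rightarrow> ('a \<Rightarrow> 'a) set" where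
  "Aut br = {\<Phi>. linear \<Phi> \<and> bij \<Phi> \<and> (\<forall>x y. \<Phi> (br x y) = br (\<Phi> x) (\<Phi> y))}"

text \<open>An endomorphism of \<open>real ^ 'n\<close> is identified with its matrix \<open>A\<close> in the basis
  \<open>axis j 1\<close>; the entry in row \<open>k\<close> and column \<open>j\<close> is \<open>A $ k $ j\<close>.\<close>

definition complex_structures :: "(real^'n \<Rightarrow> real^'n \<Rightarrow> real^'n) \<Rightarrow> (real^'n^'n) set" where
  "complex_structures br = {A. complex_structure br ((*v) A)}"

definition aut_orbit ::
    "(real^'n \<Rightarrow> real^'n \<Rightarrow> real^'n) \<Rightarrow> real^'n^'n \<Rightarrow> (real^'n^'n) set" where
  "aut_orbit br A = {matrix (inv \<Phi> \<circ> (*v) A \<circ> \<Phi>) | \<Phi>. \<Phi> \<in> Aut br}"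

definition equivalent ::
    "(real^'n \<Rightarrow> real^'n \<Rightarrow> real^'n) \<Rightarrow> real^'n^'n \<Rightarrow> real^'n^'n \<Rightarrow> bool" where
  "equivalent br A B \<longleftrightarrow> B \<in> aut_orbit br A"


section \<open>The Lie algebra \<open>M18\<^sub>1\<close>\<close>

text \<open>The basis vector \<open>x\<^sub>i\<close> is \<open>axis i 1\<close>. In the index type \<open>6\<close> the
  numeral \<open>6\<close> denotes \<open>0\<close>, so \<open>1, \<dots>, 6\<close> are its six distinct elements.\<close>

definition M18_1 :: "real^6 \<Rightarrow> real^6 \<Rightarrow> real^6" where
  "M18_1 u v =
     (u$1 * v$2 - u$2 * v$1) *\<^sub>R axis 3 1 +
     (u$1 * v$3 - u$3 * v$1) *\<^sub>R axis 4 1 +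
     (u$2 * v$3 - u$3 * v$2) *\<^sub>R axis 5 1 +
     (u$1 * v$4 - u$4 * v$1 + u$2 * v$5 - u$5 * v$2) *\<^sub>R axis 6 1"

definition J_M18_1 :: "real \<Rightarrow> real^6^6" where
  "J_M18_1 \<epsilon> = vector
    [vector [0, -1,  0,       0,  0,  0],
     vector [1,  0,  0,       0,  0,  0],
     vector [0,  0,  0,       0,  0,  \<epsilon>],
     vector [0,  0,  0,       0, -1,  0],
     vector [0,  0,  0,       1,  0,  0],
     vector [0,  0, -(1 / \<epsilon>), 0,  0,  0]]"

lemma exhaust_6:
  fixes i :: 6
  shows "i = 1 \<or> i = 2 \<or> i = 3 \<or> i = 4 \<or> i = 5 \<or> i = 6"
proof (induct i)
  case (of_int z)
  then have "z = 0 \<or> z = 1 \<or> z = 2 \<or> z = 3 \<or> z = 4 \<or> z = 5" by auto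
  then show ?case by auto
qed

lemma forall_6: "(\<forall>i::6. P i) \<longleftrightarrow> P 1 \<and> P 2 \<and> P 3 \<and> P 4 \<and> P 5 \<and> P 6"
  by (metis exhaust_6)

lemma vector_6 [simp]:
  "(vector [a, b, c, d, e, f] :: 'a::zero^6) $ 1 = a"
  "(vector [a, b, c, d, e, f] :: 'a::zero^6) $ 2 = b"
  "(vector [a, b, c, d, e, f] :: 'a::zero^6) $ 3 = c"
  "(vector [a, b, c, d, e, f] :: 'a::zero^6) $ 4 = d"
  "(vector [a, b, c, d, e, f] :: 'a::zero^6) $ 5 = e"
  "(vector [a, b, c, d, e, f] :: 'a::zero^6) $ 6 = f"
  unfolding vector_def by simp_all

lemma lie_bracket_M18_1: "lie_bracket M18_1"
  unfolding lie_bracket_def bilinear_def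
  by (auto intro!: linearI simp: M18_1_def vec_eq_iff forall_6 axis_def algebra_simps)

lemma M18_1_basis:
  "M18_1 (axis 1 1) (axis 2 1) = axis 3 1"
  "M18_1 (axis 1 1) (axis 3 1) = axis 4 1"
  "M18_1 (axis 1 1) (axis 4 1) = axis 6 1"
  "M18_1 (axis 2 1) (axis 3 1) = axis 5 1"
  "M18_1 (axis 2 1) (axis 5 1) = axis 6 1"
  by (auto simp: M18_1_def axis_def vec_eq_iff)

lemma M18_1_basis_zero:
  assumes "(i, j) \<notin> {(1,2), (1,3), (1,4), (2,3), (2,5)}"
    and "(j, i) \<notin> {(1,2), (1,3), (1,4), (2,3), (2,5)}"
  shows "M18_1 (axis i 1) (axis j 1) = 0"
  using assms exhaust_6[of i] exhaust_6[of j]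
  by (elim disjE) (simp_all add: M18_1_def axis_def vec_eq_iff)

end

theory Submission
  imports Defs
begin

text \<open>For a complex structure \<open>J\<close> put \<open>w = J x\<^sub>6\<close>. As \<open>x\<^sub>6\<close> is central, integrability says that
  \<open>ad w\<close> commutes with \<open>J\<close>. This forces \<open>w\<close> into the derived algebra, with nonzero \<open>x\<^sub>3\<close>-coordinate
  \<open>c\<close>, so the kernel \<open>\<langle>x\<^sub>3, \<dots>, x\<^sub>6\<rangle>\<close> and the image of \<open>ad w\<close> are \<open>J\<close>-invariant. The remaining
  integrability condition makes \<open>J\<close> a rotation by \<open>\<plusminus>90\<close> degrees modulo the derived algebra.
  Hence \<open>J\<close> is a rational function of that sign and of the coordinates \<open>3, \<dots>, 6\<close> of \<open>J x\<^sub>1\<close> and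
  \<open>J x\<^sub>6\<close>, and every choice of these with \<open>c \<noteq> 0\<close> occurs: locally the complex structures form a
  graph over eight coordinates. The sign of \<open>c\<close> decides between the two orbits.\<close>

section \<open>Smooth maps and graphs\<close>

text \<open>Openness makes equality on \<open>U\<close> an equality near each point, so the
  derivatives agree on \<open>U\<close> as well and the induction passes to them.\<close>

lemma Ck_on_cong:
  assumes "open U" "\<And>x. x \<in> U \<Longrightarrow> f x = g x" "Ck_on k f U"
  shows "Ck_on k g U"
  using assms(2,3)
proof (induction k arbitrary: f g)
  case 0
  then show ?case using continuous_on_cong by fastforce
next
  case (Suc k)
  have der: "(g has_derivative frechet_derivative f (at x)) (at x)" if "x \<in> U" for x
  proof (rule has_derivative_transform_within_open[OF _ \<open>open U\<close> that])
    show "(f has_derivative frechet_derivative f (at x)) (at x)"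
      using Suc.prems(2) that by (simp add: frechet_derivative_works[symmetric])
  qed (use Suc.prems in auto)
  then have "frechet_derivative f (at x) = frechet_derivative g (at x)" if "x \<in> U" for x
    using that frechet_derivative_at by blast
  with Suc.IH[of "\<lambda>x. frechet_derivative f (at x) v" "\<lambda>x. frechet_derivative g (at x) v" for v]
  have "Ck_on k (\<lambda>x. frechet_derivative g (at x) v) U" for v
    using Suc.prems(2) by simp
  then show ?case
    using der differentiableI by fastforce
qed

text \<open>Replaces the choice operator \<open>frechet_derivative\<close> by an explicit formula
  for the derivative; the closure properties below all rest on this.\<close>

lemma Ck_on_SucI:
  assumes "open U" "\<And>x. x \<in> U \<Longrightarrow> (f has_derivative f' x) (at x)"
    and "\<And>v. Ck_on k (\<lambda>x. f' x v) U"
  shows "Ck_on (Suc k) f U"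
proof -
  have "f' x v = frechet_derivative f (at x) v" if "x \<in> U" for x v
    using assms(2)[OF that] frechet_derivative_at by metis
  then have "Ck_on k (\<lambda>x. frechet_derivative f (at x) v) U" for v
    by (rule Ck_on_cong[OF assms(1) _ assms(3)])
  then show ?thesis
    using assms(2) differentiableI by fastforce
qed

lemma Ck_on_SucD:
  assumes "Ck_on (Suc k) f U"
  shows "\<And>x. x \<in> U \<Longrightarrow> (f has_derivative frechet_derivative f (at x)) (at x)"
    and "\<And>v. Ck_on k (\<lambda>x. frechet_derivative f (at x) v) U"
  using assms by (simp_all add: frechet_derivative_works[symmetric])

lemma Ck_on_Suc_imp:
  assumes "Ck_on (Suc k) f U"
  shows "Ck_on k f U"
  using assms
proof (induction k arbitrary: f)
  case 0
  then show ?case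
    by (auto intro!: differentiable_imp_continuous_on differentiable_at_imp_differentiable_on)
next
  case (Suc k)
  then show ?case by (metis Ck_on.simps(2))
qed

lemma Ck_on_const: "open U \<Longrightarrow> Ck_on k (\<lambda>x. c) U"
  by (induction k arbitrary: c)
    (auto intro!: Ck_on_SucI[where f' = "\<lambda>x v. 0"] simp del: Ck_on.simps(2))

lemma Ck_on_linear:
  assumes "open U" "linear f"
  shows "Ck_on k f U"
proof (cases k)
  case 0
  then show ?thesis using assms(2) by (simp add: linear_continuous_on linear_conv_bounded_linear)
next
  case (Suc m)
  show ?thesis unfolding Suc
    using assms Ck_on_const
    by (intro Ck_on_SucI[where f' = "\<lambda>x. f"])
      (auto intro: bounded_linear_imp_has_derivative simp: linear_conv_bounded_linear)
qed

lemma Ck_on_compose_linear: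
  assumes "open U" "linear h" "Ck_on k f U"
  shows "Ck_on k (\<lambda>x. h (f x)) U"
  using assms(3)
proof (induction k arbitrary: f)
  case 0
  then show ?case
    using continuous_on_compose2[OF linear_continuous_on[where s = UNIV] , of h U f] assms(2)
    by (simp add: linear_conv_bounded_linear)
next
  case (Suc k)
  then show ?case
    using assms(1,2)
    by (intro Ck_on_SucI[where f' = "\<lambda>x v. h (frechet_derivative f (at x) v)"])
      (auto dest: Ck_on_SucD intro: bounded_linear.has_derivative
        simp: linear_conv_bounded_linear simp del: Ck_on.simps(2))
qed

lemma Ck_on_add:
  assumes "open U" "Ck_on k f U" "Ck_on k g U"
  shows "Ck_on k (\<lambda>x. f x + g x) U"
  using assms(2,3)
proof (induction k arbitrary: f g)
  case 0
  then show ?case by (simp add: continuous_on_add)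
next
  case (Suc k)
  show ?case
    using assms(1) Suc.IH Ck_on_SucD[OF Suc.prems(1)] Ck_on_SucD[OF Suc.prems(2)]
    by (intro Ck_on_SucI[where f' = "\<lambda>x v. frechet_derivative f (at x) v + frechet_derivative g (at x) v"])
      (auto intro: has_derivative_add)
qed

text \<open>The product rule mixes derivatives with the undifferentiated factors, which therefore
  have to be lowered to order \<open>k\<close> by \<open>Ck_on_Suc_imp\<close> before the induction
  hypothesis applies.\<close>

lemma Ck_on_mult:
  fixes f g :: "'a::euclidean_space \<Rightarrow> real"
  assumes "open U" "Ck_on k f U" "Ck_on k g U"
  shows "Ck_on k (\<lambda>x. f x * g x) U"
  using assms(2,3)
proof (induction k arbitrary: f g)
  case 0
  then show ?case by (simp add: continuous_on_mult)
next
  case (Suc k)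
  show ?case
    using assms(1) Suc.IH Ck_on_SucD[OF Suc.prems(1)] Ck_on_SucD[OF Suc.prems(2)]
      Ck_on_Suc_imp[OF Suc.prems(1)] Ck_on_Suc_imp[OF Suc.prems(2)]
    by (intro Ck_on_SucI[where
          f' = "\<lambda>x v. f x * frechet_derivative g (at x) v + frechet_derivative f (at x) v * g x"])
      (auto intro: has_derivative_mult Ck_on_add)
qed

text \<open>The derivative of \<open>1/f\<close> is again built from \<open>1/f\<close>, now needed
  only at order \<open>k\<close>, where the induction hypothesis supplies it.\<close>

lemma Ck_on_inverse:
  fixes f :: "'a::euclidean_space \<Rightarrow> real"
  assumes "open U" "\<And>x. x \<in> U \<Longrightarrow> f x \<noteq> 0" "Ck_on k f U"
  shows "Ck_on k (\<lambda>x. inverse (f x)) U"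
  using assms(3)
proof (induction k)
  case 0
  then show ?case using assms(2) by (simp add: continuous_on_inverse)
next
  case (Suc k)
  have inv: "Ck_on k (\<lambda>x. inverse (f x)) U"
    using Suc.IH Ck_on_Suc_imp[OF Suc.prems] by blast
  have "Ck_on k (\<lambda>x. - (inverse (f x) * frechet_derivative f (at x) v * inverse (f x))) U" for v
    by (intro Ck_on_compose_linear[of U uminus] Ck_on_mult inv assms(1) Ck_on_SucD(2)[OF Suc.prems]
        linear_uminus)
  then show ?case
    using assms(1,2) Ck_on_SucD(1)[OF Suc.prems]
    by (intro Ck_on_SucI[where
          f' = "\<lambda>x v. - (inverse (f x) * frechet_derivative f (at x) v * inverse (f x))"])
      (auto intro: has_derivative_inverse)
qed

lemma Ck_on_sum:
  assumes "open U" "\<And>i. i \<in> I \<Longrightarrow> Ck_on k (f i) U"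
  shows "Ck_on k (\<lambda>x. \<Sum>i\<in>I. f i x) U"
  using assms(2)
  by (induction I rule: infinite_finite_induct) (simp_all add: Ck_on_const Ck_on_add assms(1))

lemma Ck_on_componentwise:
  assumes "open U" "\<And>b. b \<in> Basis \<Longrightarrow> Ck_on k (\<lambda>x. f x \<bullet> b) U"
  shows "Ck_on k f U"
proof -
  have "linear (\<lambda>t. t *\<^sub>R b)" for b :: 'b
    by (simp add: linear_iff scaleR_left_distrib)
  then have "Ck_on k (\<lambda>x. \<Sum>b\<in>Basis. (f x \<bullet> b) *\<^sub>R b) U"
    using assms by (intro Ck_on_sum Ck_on_compose_linear[where h = "\<lambda>t. t *\<^sub>R b" for b]) auto
  then show ?thesis by (simp add: euclidean_representation)
qed

section \<open>Closure properties of smooth maps\<close>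

lemma smooth_on_imp_continuous_on: "smooth_on U f \<Longrightarrow> continuous_on U f"
  unfolding smooth_on_def by (metis Ck_on.simps(1))

lemma smooth_on_subset:
  assumes "smooth_on U f" "V \<subseteq> U"
  shows "smooth_on V f"
proof -
  have "Ck_on k f U \<Longrightarrow> Ck_on k f V" for k
    using assms(2) by (induction k arbitrary: f) (auto intro: continuous_on_subset)
  then show ?thesis using assms(1) by (auto simp: smooth_on_def)
qed

lemma smooth_on_linear: "open U \<Longrightarrow> linear f \<Longrightarrow> smooth_on U f"
  by (simp add: smooth_on_def Ck_on_linear)

lemma smooth_on_const: "open U \<Longrightarrow> smooth_on U (\<lambda>x. c)"
  by (simp add: smooth_on_def Ck_on_const)

lemma smooth_on_add:
  "open U \<Longrightarrow> smooth_on U f \<Longrightarrow> smooth_on U g \<Longrightarrow> smooth_on U (\<lambda>x. f x + g x)"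
  by (simp add: smooth_on_def Ck_on_add)

lemma smooth_on_minus: "open U \<Longrightarrow> smooth_on U f \<Longrightarrow> smooth_on U (\<lambda>x. - f x)"
  using Ck_on_compose_linear[of U uminus] linear_uminus by (auto simp: smooth_on_def)

lemma smooth_on_diff:
  "open U \<Longrightarrow> smooth_on U f \<Longrightarrow> smooth_on U g \<Longrightarrow> smooth_on U (\<lambda>x. f x - g x)"
  using smooth_on_add[of U f "\<lambda>x. - g x"] smooth_on_minus[of U g] by simp

lemma smooth_on_mult:
  fixes f g :: "'a::euclidean_space \<Rightarrow> real"
  shows "open U \<Longrightarrow> smooth_on U f \<Longrightarrow> smooth_on U g \<Longrightarrow> smooth_on U (\<lambda>x. f x * g x)"
  by (simp add: smooth_on_def Ck_on_mult)

lemma smooth_on_divide: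
  fixes f g :: "'a::euclidean_space \<Rightarrow> real"
  assumes "open U" "smooth_on U f" "smooth_on U g" "\<And>x. x \<in> U \<Longrightarrow> g x \<noteq> 0"
  shows "smooth_on U (\<lambda>x. f x / g x)"
  using assms by (simp add: smooth_on_def divide_inverse Ck_on_mult Ck_on_inverse)

lemma smooth_on_matrix:
  fixes f :: "'a::euclidean_space \<Rightarrow> real^'n^'m"
  assumes "open U" "\<And>i j. smooth_on U (\<lambda>x. f x $ i $ j)"
  shows "smooth_on U f"
  unfolding smooth_on_def
proof (rule allI, rule Ck_on_componentwise[OF assms(1)])
  fix k and b :: "real^'n^'m"
  assume "b \<in> Basis"
  then obtain i j where "b = axis i (axis j 1)"
    by (auto simp: Basis_vec_def)
  then show "Ck_on k (\<lambda>x. f x \<bullet> b) U"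
    using assms(2)[of i j] by (simp add: inner_axis smooth_on_def)
qed

text \<open>The fixed points of \<open>G\<close> form the graph, over the range of the projection \<open>P\<close>, of the
  complementary part of \<open>G\<close>; subtracting that part flattens the graph.\<close>

lemma submanifold_graph:
  fixes S :: "'a::euclidean_space set" and P :: "'a \<Rightarrow> 'a"
  assumes lin: "linear P" and idem: "\<And>x. P (P x) = P x"
    and cover: "\<And>p. p \<in> S \<Longrightarrow> \<exists>U W G. p \<in> U \<and> open U \<and> U \<subseteq> W \<and> open W \<and> smooth_on W G \<and>
      (\<forall>x. P x \<in> W \<longleftrightarrow> x \<in> W) \<and> (\<forall>x\<in>W. G (P x) = G x \<and> P (G x) = P x) \<and>
      S \<inter> U = {x \<in> U. G x = x}"
  shows "submanifold (dim (range P)) S"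
  unfolding submanifold_def
proof
  fix p assume "p \<in> S"
  from cover[OF this] obtain U W G where *: "p \<in> U" "open U" "U \<subseteq> W" "open W" "smooth_on W G"
    and W: "\<And>x. P x \<in> W \<longleftrightarrow> x \<in> W" and G: "\<And>x. x \<in> W \<Longrightarrow> G (P x) = G x \<and> P (G x) = P x"
    and S: "S \<inter> U = {x \<in> U. G x = x}"
    by blast
  \<comment> \<open>Both maps are shears: the vector \<open>G x - P x\<close> depends only on
    \<open>P x\<close> and is killed by \<open>P\<close>. So they preserve \<open>P\<close> and are
    inverse to each other on \<open>W\<close>.\<close>
  define \<phi> where "\<phi> x = x - (G x - P x)" for x
  define \<psi> where "\<psi> x = x + (G x - P x)" for x
  have P\<phi>: "P (\<phi> x) = P x" and P\<psi>: "P (\<psi> x) = P x" if "x \<in> W" for x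
    using G[OF that] idem by (simp_all add: \<phi>_def \<psi>_def linear_add linear_diff lin)
  have \<phi>W: "\<phi> x \<in> W" and \<psi>W: "\<psi> x \<in> W" if "x \<in> W" for x
    using P\<phi>[OF that] P\<psi>[OF that] W that by metis+
  have \<psi>\<phi>: "\<psi> (\<phi> x) = x" and \<phi>\<psi>: "\<phi> (\<psi> x) = x" if "x \<in> W" for x
    using G[OF \<phi>W[OF that]] G[OF \<psi>W[OF that]] G[OF that] P\<phi>[OF that] P\<psi>[OF that]
    unfolding \<phi>_def[of "\<psi> x"] \<psi>_def[of "\<phi> x"] by (simp_all add: \<phi>_def \<psi>_def)
  have smooth: "smooth_on W \<phi>" "smooth_on W \<psi>"
    unfolding \<phi>_def \<psi>_def
    by (intro smooth_on_diff smooth_on_add smooth_on_linear[OF _ lin]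
        smooth_on_linear[where f = "\<lambda>x. x"] linear_ident *)+
  \<comment> \<open>This is the image of \<open>U\<close> under \<open>\<phi>\<close>, written as a
    preimage so that continuity of \<open>\<psi>\<close> gives openness.\<close>
  define V where "V = W \<inter> \<psi> -` U"
  have "open V"
    unfolding V_def
    using smooth_on_imp_continuous_on[OF smooth(2)] * continuous_open_preimage by blast
  have "homeomorphism U V \<phi> \<psi>"
    using \<psi>\<phi> \<phi>\<psi> \<phi>W \<psi>W *(3) smooth[THEN smooth_on_imp_continuous_on]
    unfolding V_def
    by (intro homeomorphismI) (auto simp: subset_iff intro: continuous_on_subset)
  then have "diffeomorphism U V \<phi> \<psi>"
    unfolding diffeomorphism_def
    using *(2,3) \<open>open V\<close> smooth smooth_on_subset by (auto simp: V_def)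
  moreover have "\<phi> ` (U \<inter> S) = V \<inter> range P"
  proof
    show "\<phi> ` (U \<inter> S) \<subseteq> V \<inter> range P"
    proof
      fix y assume "y \<in> \<phi> ` (U \<inter> S)"
      then obtain x where x: "x \<in> U" "x \<in> S" "y = \<phi> x" by blast
      then have "G x = x" using S by blast
      then have "y = P x" by (simp add: x(3) \<phi>_def)
      moreover have "y \<in> V" using x *(3) \<phi>W \<psi>\<phi> by (auto simp: V_def subset_iff)
      ultimately show "y \<in> V \<inter> range P" by blast
    qed
    show "V \<inter> range P \<subseteq> \<phi> ` (U \<inter> S)"
    proof
      fix y assume "y \<in> V \<inter> range P"
      then have y: "y \<in> W" "\<psi> y \<in> U" "P y = y" using idem by (auto simp: V_def)
      \<comment> \<open>For \<open>y\<close> in the range of \<open>P\<close>,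
        \<open>\<psi> y\<close> is the point of the graph lying over \<open>y\<close>.\<close>
      then have "\<psi> y = G y" by (simp add: \<psi>_def)
      then have "G (\<psi> y) = \<psi> y"
        using G[OF \<psi>W[OF y(1)]] P\<psi>[OF y(1)] y(3) by metis
      then have "\<psi> y \<in> U \<inter> S" using S y by blast
      then show "y \<in> \<phi> ` (U \<inter> S)" using \<phi>\<psi>[OF y(1)] by (metis imageI)
    qed
  qed
  moreover have "subspace (range P)"
    by (simp add: lin linear_subspace_image)
  ultimately show "\<exists>U V (\<phi> :: 'a \<Rightarrow> 'a) \<psi> L. p \<in> U \<and> diffeomorphism U V \<phi> \<psi> \<and>
      subspace L \<and> dim L = dim (range P) \<and> \<phi> ` (U \<inter> S) = V \<inter> L"
    using *(1) by blast
qed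


section \<open>Complex structures on \<open>M18\<^sub>1\<close> in coordinates\<close>

lemma sum_6: "(\<Sum>i\<in>(UNIV::6 set). f i) = f 1 + f 2 + f 3 + f 4 + f 5 + (f 6 :: 'a::comm_monoid_add)"
proof -
  have U: "(UNIV :: 6 set) = {1, 2, 3, 4, 5, 6}"
    using exhaust_6 by blast
  show ?thesis unfolding U by (simp add: add.assoc)
qed

definition comps :: "real \<Rightarrow> real \<Rightarrow> real \<Rightarrow> real \<Rightarrow> real \<Rightarrow> real \<Rightarrow> real^6" where
  "comps a b c d e f = vector [a, b, c, d, e, f]"

lemma comps_nth [simp]:
  "comps a b c d e f $ 1 = a" "comps a b c d e f $ 2 = b" "comps a b c d e f $ 3 = c"
  "comps a b c d e f $ 4 = d" "comps a b c d e f $ 5 = e" "comps a b c d e f $ 6 = f"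
  by (simp_all add: comps_def)

lemma vec6_eq_iff:
  fixes u v :: "'a^6"
  shows "u = v \<longleftrightarrow> u$1 = v$1 \<and> u$2 = v$2 \<and> u$3 = v$3 \<and> u$4 = v$4 \<and> u$5 = v$5 \<and> u$6 = v$6"
  by (simp add: vec_eq_iff forall_6)

lemma axis_nth6 [simp]:
  "(axis i x :: 'a::zero^6) $ j = (if j = i then x else 0)"
  by (simp add: axis_def)

lemma M18_1_nth [simp]:
  "M18_1 u v $ 1 = 0"
  "M18_1 u v $ 2 = 0"
  "M18_1 u v $ 3 = u$1 * v$2 - u$2 * v$1"
  "M18_1 u v $ 4 = u$1 * v$3 - u$3 * v$1"
  "M18_1 u v $ 5 = u$2 * v$3 - u$3 * v$2"
  "M18_1 u v $ 6 = u$1 * v$4 - u$4 * v$1 + u$2 * v$5 - u$5 * v$2"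
  by (simp_all add: M18_1_def)

lemma matrix_mult_axis: "(A *v axis j 1) $ i = (A $ i $ j :: real)"
  by (simp add: matrix_vector_mult_basis column_def)

lemma matrix_vector_mult_nth6:
  "((A::real^6^'n) *v x) $ i =
    A$i$1 * x$1 + A$i$2 * x$2 + A$i$3 * x$3 + A$i$4 * x$4 + A$i$5 * x$5 + A$i$6 * x$6"
  by (simp add: matrix_vector_mult_def sum_6)

text \<open>With \<open>w = (0, 0, c, d, e, f)\<close> and \<open>(p, q, r, s)\<close> the tail of \<open>J x\<^sub>1\<close>, the columns solve
  \<open>J x\<^sub>6 = w\<close>, \<open>J w = - x\<^sub>6\<close>, \<open>J (c x\<^sub>4 + d x\<^sub>6) = \<eta> (c x\<^sub>5 + e x\<^sub>6)\<close>,
  \<open>J (c x\<^sub>5 + e x\<^sub>6) = - \<eta> (c x\<^sub>4 + d x\<^sub>6)\<close> and \<open>J\<^sup>2 x\<^sub>1 = - x\<^sub>1\<close>; here \<open>\<eta> = \<plusminus>1\<close>, \<open>c \<noteq> 0\<close>.\<close>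

definition J_param :: "real \<Rightarrow> real \<Rightarrow> real \<Rightarrow> real \<Rightarrow> real \<Rightarrow> real \<Rightarrow> real \<Rightarrow> real \<Rightarrow> real \<Rightarrow> real^6^6" where
  "J_param \<eta> c d e f p q r s =
    (let D = d / c; E = e / c; Q = D * D + E * E - f / c;
      a33 = Q * c; a43 = Q * d + \<eta> * E; a53 = Q * e - \<eta> * D; a63 = Q * f - 1 / c;
      a34 = - d; a44 = - D * d; a54 = \<eta> - D * e; a64 = \<eta> * E - D * f;
      a35 = - e; a45 = - \<eta> - E * d; a55 = - E * e; a65 = - \<eta> * D - E * f
    in vector
    [vector [0, - \<eta>, 0, 0, 0, 0],
     vector [\<eta>, 0, 0, 0, 0, 0],
     vector [p, - \<eta> * (p * a33 + q * a34 + r * a35 + s * c), a33, a34, a35, c],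
     vector [q, - \<eta> * (p * a43 + q * a44 + r * a45 + s * d), a43, a44, a45, d],
     vector [r, - \<eta> * (p * a53 + q * a54 + r * a55 + s * e), a53, a54, a55, e],
     vector [s, - \<eta> * (p * a63 + q * a64 + r * a65 + s * f), a63, a64, a65, f]])"

lemma linear_M18_1:
  "linear (\<lambda>x. M18_1 x y)" "linear (M18_1 x)"
  using lie_bracket_M18_1 by (simp_all add: lie_bracket_def bilinear_def)

lemmas M18_1_linear_simps =
  linear_M18_1[THEN linear_add] linear_M18_1[THEN linear_diff] linear_M18_1[THEN linear_neg]
  linear_M18_1[THEN linear_scale] linear_M18_1[THEN linear_0]

lemma M18_1_commute: "M18_1 x y = - M18_1 y x"
  by (simp add: vec6_eq_iff)

text \<open>Since \<open>N (J x) y = - J (N x y)\<close> for the Nijenhuis tensor \<open>N\<close>, and \<open>N\<close> vanishes on a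
  \<open>J\<close>-invariant abelian ideal of codimension 2, few values of \<open>N\<close> have to be checked.\<close>

lemma complex_structure_M18_1I:
  assumes lin: "linear J" and sq: "\<And>i. J (J (axis i 1)) = - axis i 1"
    and ideal: "\<And>y. y$1 = 0 \<Longrightarrow> y$2 = 0 \<Longrightarrow> J y $ 1 = 0 \<and> J y $ 2 = 0"
    and J1: "J (axis 1 1) $ 2 \<noteq> 0"
    and br: "\<And>y. y$1 = 0 \<Longrightarrow> y$2 = 0 \<Longrightarrow>
      M18_1 (J (axis 1 1)) (J y) - M18_1 (axis 1 1) y
        - J (M18_1 (J (axis 1 1)) y) - J (M18_1 (axis 1 1) (J y)) = 0"
  shows "complex_structure M18_1 J"
proof -
  define N where "N x y = M18_1 (J x) (J y) - M18_1 x y - J (M18_1 (J x) y) - J (M18_1 x (J y))" for x y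
  note J_simps = linear_add[OF lin] linear_diff[OF lin] linear_neg[OF lin] linear_scale[OF lin]
  have "J \<circ> J = uminus"
    using sq by (intro linear_eq_stdbasis linear_compose lin linear_uminus) (auto simp: Basis_vec_def)
  then have sq': "J (J x) = - x" for x
    by (metis comp_apply)
  have "bilinear N"
    unfolding bilinear_def N_def
    by (auto intro!: linearI simp: M18_1_linear_simps J_simps algebra_simps)
  then have N_simps: "N (x + y) z = N x z + N y z" "N z (x + y) = N z x + N z y"
    "N (a *\<^sub>R x) z = a *\<^sub>R N x z" "N z (a *\<^sub>R x) = a *\<^sub>R N z x" for x y z a
    by (simp_all add: bilinear_ladd bilinear_radd bilinear_lmul bilinear_rmul)
  have anti: "N x y = - N y x" for x y
    unfolding N_def
    by (simp add: M18_1_commute[of x] M18_1_commute[of "J x"] J_simps)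
  have N_refl: "N x x = 0" for x using anti[of x x] by (simp add: vec_eq_iff)
  have N_J: "N x (J y) = - J (N x y)" for x y
    unfolding N_def by (simp add: sq' J_simps M18_1_linear_simps)
  have N_ideal: "N x y = 0" if "x$1 = 0" "x$2 = 0" "y$1 = 0" "y$2 = 0" for x y
  proof -
    have "M18_1 u v = 0" if "u$1 = 0" "u$2 = 0" "v$1 = 0" "v$2 = 0" for u v
      using that by (simp add: vec6_eq_iff)
    then show ?thesis using that ideal[of x] ideal[of y] linear_0[OF lin] by (simp add: N_def)
  qed
  let ?u = "axis 1 1 :: real^6"
  have N1: "N ?u y = 0" if "y$1 = 0" "y$2 = 0" for y
    unfolding N_def using that by (rule br)
  have NJ1: "N (J ?u) y = 0" if "y$1 = 0" "y$2 = 0" for y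
    using N1[OF that] anti[of y ?u] anti[of "J ?u" y] by (simp add: N_J linear_0[OF lin])
  have N11: "N ?u (J ?u) = 0" "N (J ?u) ?u = 0"
    using anti[of "J ?u" ?u] by (simp_all add: N_J N_refl linear_0[OF lin])
  \<comment> \<open>Since J x1 has a nonzero second coordinate, x1 and J x1 span a complement of the
    ideal.\<close>
  have decomp: "\<exists>a b y. x = a *\<^sub>R ?u + (b *\<^sub>R J ?u + y) \<and> y$1 = 0 \<and> y$2 = 0" for x
  proof -
    define b where "b = x$2 / J ?u $ 2"
    define a where "a = x$1 - b * J ?u $ 1"
    define y where "y = x - a *\<^sub>R ?u - b *\<^sub>R J ?u"
    have "y$1 = 0" "y$2 = 0" using J1 by (simp_all add: y_def a_def b_def)
    moreover have "x = a *\<^sub>R ?u + (b *\<^sub>R J ?u + y)" by (simp add: y_def)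
    ultimately show ?thesis by blast
  qed
  have "N x x' = 0" for x x'
  proof -
    from decomp[of x] decomp[of x'] obtain a b y a' b' y'
      where "x = a *\<^sub>R ?u + (b *\<^sub>R J ?u + y)" "y$1 = 0" "y$2 = 0"
        and "x' = a' *\<^sub>R ?u + (b' *\<^sub>R J ?u + y')" "y'$1 = 0" "y'$2 = 0" by blast
    moreover have "N y ?u = 0" "N y (J ?u) = 0" if "y$1 = 0" "y$2 = 0" for y
      using N1[OF that] NJ1[OF that] anti[of y] by simp_all
    ultimately show ?thesis
      using N1 NJ1 N_ideal by (simp add: N_simps N11 N_refl)
  qed
  then show ?thesis
    unfolding complex_structure_def N_def using lin sq' by simp
qed

lemma J_param_in_complex_structures:
  assumes c: "c \<noteq> 0" and \<eta>: "\<eta> * \<eta> = 1"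
  shows "J_param \<eta> c d e f p q r s \<in> complex_structures M18_1"
proof -
  define D E Q where "D = d / c" and "E = e / c" and "Q = D * D + E * E - f / c"
  \<comment> \<open>After this substitution the quotients by \<open>c\<close> inside
    \<open>J_param\<close> cancel; only the entry with \<open>1 / c\<close> keeps a
    denominator.\<close>
  have "d = c * D" and "e = c * E" and "f = c * (D * D + E * E - Q)"
    using c by (simp_all add: D_def E_def Q_def)
  note subst = this
  have \<eta>_cases: "\<eta> = 1 \<or> \<eta> = - 1"
    using \<eta> by (simp add: square_eq_1_iff)
  note expand = vec6_eq_iff matrix_vector_mult_nth6 J_param_def Let_def
  show ?thesis
    unfolding complex_structures_def mem_Collect_eq subst
  proof (rule complex_structure_M18_1I, goal_cases)
    case (2 i)
    then show ?case
      using exhaust_6[of i] \<eta>_cases c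
      by (elim disjE) (simp_all add: expand, simp_all add: field_simps)
  next
    case (5 y)
    then show ?case
      using \<eta>_cases c
      by (elim disjE) (simp_all add: expand, simp_all add: field_simps)
  qed (use c \<eta>_cases in \<open>auto simp: expand\<close>)
qed

text \<open>The two vectors rotated by J are the negatives of [w, x1] and [w, x2] for w = J x6, so
  they span the image of ad w. The final clause, that ad w commutes with J, is kept for the
  construction of automorphisms.\<close>

lemma complex_structure_M18_1E:
  assumes "complex_structure M18_1 J"
  obtains \<eta> c d e f p q r s where "c \<noteq> 0" "\<eta> * \<eta> = 1"
    "J (axis 6 1) = comps 0 0 c d e f" "J (axis 1 1) = comps 0 \<eta> p q r s"
    "J (comps 0 0 0 c 0 d) = comps 0 0 0 0 (\<eta> * c) (\<eta> * e)"
    "J (comps 0 0 0 0 c e) = comps 0 0 0 (- \<eta> * c) 0 (- \<eta> * d)"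
    "\<And>x. M18_1 (comps 0 0 c d e f) (J x) = J (M18_1 (comps 0 0 c d e f) x)"
proof -
  have lin: "linear J" and sq: "\<And>x. J (J x) = - x"
    and N: "\<And>x y. M18_1 (J x) (J y) - M18_1 x y - J (M18_1 (J x) y) - J (M18_1 x (J y)) = 0"
    using assms by (simp_all add: complex_structure_def)
  note J_simps = linear_add[OF lin] linear_diff[OF lin] linear_neg[OF lin] linear_scale[OF lin]
    linear_0[OF lin]
  define w where "w = J (axis 6 1)"
  have Jw: "J w = - axis 6 1" by (simp add: w_def sq)
  have central: "M18_1 x (axis 6 1) = 0" for x
    by (simp add: vec6_eq_iff)
  have comm: "M18_1 w (J x) = J (M18_1 w x)" for x
    using N[of "axis 6 1" x] central[of x] central[of "J x"]
    by (simp add: w_def[symmetric] M18_1_commute[of "axis 6 1"] J_simps)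
  have not_real: "w \<noteq> t *\<^sub>R axis 6 1" for t
  proof
    assume w: "w = t *\<^sub>R axis 6 1"
    have "- (axis 6 1 :: real^6) = (t * t) *\<^sub>R axis 6 1"
      using Jw w J_simps(4)[of t "axis 6 1"] by (simp add: w_def[symmetric])
    then have "t * t = - 1" by (simp add: vec6_eq_iff)
    then show False by (metis not_square_less_zero less_minus_one_simps(1))
  qed
  \<comment> \<open>An operator \<open>ad w \<circ> h\<close> with image in the center commutes with \<open>J\<close> if \<open>h\<close> does;
    as the center is not \<open>J\<close>-invariant, it vanishes.\<close>
  have no_form: "g x = 0"
    if g: "\<And>x. M18_1 w (h x) = g x *\<^sub>R axis 6 1" "\<And>x. h (J x) = J (h x)"
    for g h x
  proof (rule ccontr)
    assume "g x \<noteq> 0"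
    have "g x *\<^sub>R w = g (J x) *\<^sub>R axis 6 1"
      using g(1)[of "J x"] comm[of "h x"] g(1)[of x] by (simp add: g(2) J_simps w_def)
    then have "w = (g (J x) / g x) *\<^sub>R axis 6 1"
      using \<open>g x \<noteq> 0\<close> by (simp add: vec6_eq_iff field_simps)
    then show False using not_real by blast
  qed
  have w12: "w$1 = 0 \<and> w$2 = 0"
  proof (rule ccontr)
    assume neq: "\<not> (w$1 = 0 \<and> w$2 = 0)"
    then have "w$1 * w$1 + w$2 * w$2 \<noteq> 0"
      using sum_squares_eq_zero_iff by blast
    \<comment> \<open>The cube of ad w sends x to this scalar times x6, so \<open>no_form\<close>
      applies with the square of ad w as \<open>h\<close>.\<close>
    moreover have "(w$1 * w$1 + w$2 * w$2) * (w$1 * x$2 - w$2 * x$1) = 0" for x :: "real^6"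
      by (rule no_form[where g = "\<lambda>x. (w$1 * w$1 + w$2 * w$2) * (w$1 * x$2 - w$2 * x$1)"
          and h = "\<lambda>x. M18_1 w (M18_1 w x)"])
        (simp_all add: comm vec6_eq_iff algebra_simps)
    ultimately have "w$1 * x$2 - w$2 * x$1 = 0" for x :: "real^6"
      using mult_eq_0_iff by blast
    from this[of "axis 1 1"] this[of "axis 2 1"] neq show False by simp
  qed
  have w3: "w$3 \<noteq> 0"
  proof
    assume 0: "w$3 = 0"
    \<comment> \<open>Once the first three coordinates of w vanish, ad w is already central-valued,
      so \<open>h\<close> can be the identity.\<close>
    have "- w$4 * x$1 - w$5 * x$2 = 0" for x :: "real^6"
      by (rule no_form[where g = "\<lambda>x. - w$4 * x$1 - w$5 * x$2" and h = "\<lambda>x. x"])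
        (simp_all add: vec6_eq_iff w12 0)
    from this[of "axis 1 1"] this[of "axis 2 1"] have "w = w$6 *\<^sub>R axis 6 1"
      by (simp add: vec6_eq_iff w12 0)
    then show False using not_real by blast
  qed
  define c d e f where "c = w$3" and "d = w$4" and "e = w$5" and "f = w$6"
  have w: "w = comps 0 0 c d e f"
    by (simp add: vec6_eq_iff w12 c_def d_def e_def f_def)
  have c: "c \<noteq> 0" using w3 by (simp add: c_def)
  have ad_w: "M18_1 w x = - (x$1 *\<^sub>R comps 0 0 0 c 0 d + x$2 *\<^sub>R comps 0 0 0 0 c e)" for x
    by (simp add: vec6_eq_iff w)
  let ?u = "axis 1 1 :: real^6" and ?y4 = "comps 0 0 0 c 0 d" and ?y5 = "comps 0 0 0 0 c e"
  define \<alpha> \<eta> where "\<alpha> = J ?u $ 1" and "\<eta> = J ?u $ 2"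
  \<comment> \<open>Apply J to \<open>?y4\<close> = - [w, x1] and move J inside the bracket; only
    coordinates 1 and 2 of J x1 survive.\<close>
  have Jy4: "J ?y4 = \<alpha> *\<^sub>R ?y4 + \<eta> *\<^sub>R ?y5"
    using arg_cong[OF comm[of ?u], of uminus]
    by (simp add: ad_w \<alpha>_def \<eta>_def J_simps add.commute)
  \<comment> \<open>Integrability at x1 and \<open>?y4\<close> equates a multiple of x6 with a
    multiple of w. Coordinate 3 gives \<open>\<alpha> = 0\<close>, and then coordinate 6 gives the
    norm condition.\<close>
  have "c * (\<alpha> * \<alpha> + \<eta> * \<eta> - 1) = 0 \<and> \<alpha> = 0"
  proof -
    have br: "M18_1 (J ?u) (J ?y4) = (c * (\<alpha> * \<alpha> + \<eta> * \<eta>)) *\<^sub>R axis 6 1"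
      "M18_1 ?u ?y4 = c *\<^sub>R axis 6 1" "M18_1 (J ?u) ?y4 = (\<alpha> * c) *\<^sub>R axis 6 1"
      "M18_1 ?u (J ?y4) = (\<alpha> * c) *\<^sub>R axis 6 1"
      unfolding Jy4 by (simp_all add: vec6_eq_iff \<alpha>_def \<eta>_def algebra_simps)
    have "(c * (\<alpha> * \<alpha> + \<eta> * \<eta> - 1)) *\<^sub>R axis 6 1 = (2 * \<alpha> * c) *\<^sub>R w"
      using N[of ?u ?y4] unfolding br J_simps w_def[symmetric]
      by (simp add: vec6_eq_iff algebra_simps)
    from arg_cong[OF this, of "\<lambda>v. v $ 3"] arg_cong[OF this, of "\<lambda>v. v $ 6"] c
    show ?thesis by (simp add: w)
  qed
  then have \<alpha>: "\<alpha> = 0" and \<eta>: "\<eta> * \<eta> = 1" using c by auto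
  have "\<eta> *\<^sub>R J ?y5 = - ?y4"
    using sq[of ?y4] by (simp add: Jy4 \<alpha> J_simps)
  from arg_cong[OF this, of "(*\<^sub>R) \<eta>"] have Jy5: "J ?y5 = - \<eta> *\<^sub>R ?y4"
    by (simp add: \<eta>)
  show thesis
  proof (rule that[OF c \<eta>])
    show "J ?u = comps 0 \<eta> (J ?u $ 3) (J ?u $ 4) (J ?u $ 5) (J ?u $ 6)"
      using \<alpha> by (simp add: vec6_eq_iff \<alpha>_def \<eta>_def)
    show "J (axis 6 1) = comps 0 0 c d e f"
      using w by (simp only: w_def)
    show "J ?y4 = comps 0 0 0 0 (\<eta> * c) (\<eta> * e)" "J ?y5 = comps 0 0 0 (- \<eta> * c) 0 (- \<eta> * d)"
      unfolding Jy4 Jy5 \<alpha> by (simp_all add: vec6_eq_iff)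
    show "M18_1 (comps 0 0 c d e f) (J x) = J (M18_1 (comps 0 0 c d e f) x)" for x
      using comm[of x] by (simp only: w)
  qed
qed

text \<open>J is known on x6, w, the two vectors spanning the image of ad w, x1 and J x1. As
  \<open>c\<close> and \<open>\<eta>\<close> are nonzero these form a basis; solving for x2, ..., x5
  yields every column.\<close>

lemma complex_structures_M18_1_J_param:
  assumes "A \<in> complex_structures M18_1"
  shows "A$3$6 \<noteq> 0" "A$2$1 * A$2$1 = 1"
    "A = J_param (A$2$1) (A$3$6) (A$4$6) (A$5$6) (A$6$6) (A$3$1) (A$4$1) (A$5$1) (A$6$1)"
proof -
  define J where "J = (*v) A"
  have "complex_structure M18_1 J"
    using assms by (simp add: complex_structures_def J_def)
  then obtain \<eta> c d e f p q r s where c: "c \<noteq> 0" and \<eta>: "\<eta> * \<eta> = 1"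
    and J: "J (axis 6 1) = comps 0 0 c d e f" "J (axis 1 1) = comps 0 \<eta> p q r s"
    "J (comps 0 0 0 c 0 d) = comps 0 0 0 0 (\<eta> * c) (\<eta> * e)"
    "J (comps 0 0 0 0 c e) = comps 0 0 0 (- \<eta> * c) 0 (- \<eta> * d)"
    by (rule complex_structure_M18_1E)
  have col: "A $ i $ j = J (axis j 1) $ i" for i j
    by (simp add: J_def matrix_mult_axis)
  have lin: "linear J" and sq: "\<And>x. J (J x) = - x"
    using \<open>complex_structure M18_1 J\<close> by (simp_all add: complex_structure_def)
  note J_simps = linear_add[OF lin] linear_diff[OF lin] linear_neg[OF lin] linear_scale[OF lin]
  define D E Q where "D = d / c" and "E = e / c" and "Q = D * D + E * E - f / c"
  have x4: "axis 4 1 = (1/c) *\<^sub>R comps 0 0 0 c 0 d - D *\<^sub>R axis 6 1"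
    and x5: "axis 5 1 = (1/c) *\<^sub>R comps 0 0 0 0 c e - E *\<^sub>R axis 6 1"
    and x3: "axis 3 1 = (1/c) *\<^sub>R comps 0 0 c d e f - D *\<^sub>R axis 4 1 - E *\<^sub>R axis 5 1 - (f / c) *\<^sub>R axis 6 1"
    using c by (simp_all add: vec6_eq_iff D_def E_def)
  have J4: "J (axis 4 1) = comps 0 0 (- d) (- D * d) (\<eta> - D * e) (\<eta> * E - D * f)"
    unfolding x4 using c by (simp add: J_simps J vec6_eq_iff, simp add: D_def E_def)
  have J5: "J (axis 5 1) = comps 0 0 (- e) (- \<eta> - E * d) (- E * e) (- \<eta> * D - E * f)"
    unfolding x5 using c by (simp add: J_simps J vec6_eq_iff, simp add: D_def E_def)
  have "J (comps 0 0 c d e f) = - axis 6 1"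
    by (metis J(1) sq)
  then have J3: "J (axis 3 1) = comps 0 0 (Q * c) (Q * d + \<eta> * E) (Q * e - \<eta> * D) (Q * f - 1 / c)"
    unfolding x3 using c
    by (simp add: J_simps J J4 J5 vec6_eq_iff Q_def) (simp add: D_def E_def field_simps)
  have x2: "axis 2 1 = \<eta> *\<^sub>R (comps 0 \<eta> p q r s
      - (p *\<^sub>R axis 3 1 + q *\<^sub>R axis 4 1 + r *\<^sub>R axis 5 1 + s *\<^sub>R axis 6 1))"
    by (simp add: vec6_eq_iff \<eta>)
  have "J (comps 0 \<eta> p q r s) = - axis 1 1"
    by (metis J(2) sq)
  then have J2: "J (axis 2 1) = \<eta> *\<^sub>R (- axis 1 1 -
      (p *\<^sub>R J (axis 3 1) + q *\<^sub>R J (axis 4 1) + r *\<^sub>R J (axis 5 1) + s *\<^sub>R J (axis 6 1)))"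
    unfolding x2 by (simp only: J_simps)
  show "A$3$6 \<noteq> 0" "A$2$1 * A$2$1 = 1"
    using c \<eta> by (simp_all add: col J)
  show "A = J_param (A$2$1) (A$3$6) (A$4$6) (A$5$6) (A$6$6) (A$3$1) (A$4$1) (A$5$1) (A$6$1)"
    unfolding vec_eq_iff forall_6 J_param_def Let_def vector_6
    unfolding col J J2 J3 J4 J5
    by (simp add: D_def E_def Q_def, simp add: algebra_simps)
qed

section \<open>Automorphisms and the two orbits\<close>

text \<open>The algebra is generated by \<open>x\<^sub>1\<close> and \<open>x\<^sub>2\<close>.\<close>

definition hom_of_images :: "real^6 \<Rightarrow> real^6 \<Rightarrow> real^6 \<Rightarrow> real^6" where
  "hom_of_images X Y v = v$1 *\<^sub>R X + v$2 *\<^sub>R Y + v$3 *\<^sub>R M18_1 X Y + v$4 *\<^sub>R M18_1 X (M18_1 X Y)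
     + v$5 *\<^sub>R M18_1 Y (M18_1 X Y) + v$6 *\<^sub>R M18_1 X (M18_1 X (M18_1 X Y))"

text \<open>As x6 equals both [x1, x4] and [x2, x5], its image must be computed consistently: the
  two triple brackets have x6-coordinates \<open>a^3 b\<close> and \<open>a b^3\<close>, whence
  \<open>b * b = a * a\<close>. The vanishing of \<open>X$2\<close> and \<open>Y$1\<close> preserves
  [x1, x5] = [x2, x4] = 0.\<close>

lemma hom_of_images_in_Aut:
  assumes "X$1 = a" "X$2 = 0" "Y$1 = 0" "Y$2 = b" "b * b = a * a" "a \<noteq> 0"
  shows "hom_of_images X Y \<in> Aut M18_1"
proof -
  have b: "b = a \<or> b = - a"
    using assms(5) by (simp add: square_eq_iff)
  have lin: "linear (hom_of_images X Y)"
    by (rule linearI) (simp_all add: hom_of_images_def algebra_simps)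
  moreover have "inj (hom_of_images X Y)"
    unfolding linear_injective_0[OF lin]
    using assms b by (auto simp: hom_of_images_def vec6_eq_iff)
  ultimately have "bij (hom_of_images X Y)"
    by (simp add: bij_def linear_injective_imp_surjective)
  moreover have "hom_of_images X Y (M18_1 u v) = M18_1 (hom_of_images X Y u) (hom_of_images X Y v)" for u v
    using b by (elim disjE) (simp_all add: hom_of_images_def vec6_eq_iff assms(1-4) algebra_simps)
  ultimately show ?thesis using lin by (simp add: Aut_def)
qed

lemma J_M18_1_mult:
  "J_M18_1 \<epsilon> *v x = comps (- x$2) (x$1) (\<epsilon> * x$6) (- x$5) (x$4) (- x$3 / \<epsilon>)"
  by (simp add: vec6_eq_iff matrix_vector_mult_nth6 J_M18_1_def)

lemma inv_in_Aut:
  assumes "\<Phi> \<in> Aut br"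
  shows "inv \<Phi> \<in> Aut br"
proof -
  have lin: "linear \<Phi>" and bij: "bij \<Phi>" and hom: "\<Phi> (br x y) = br (\<Phi> x) (\<Phi> y)" for x y
    using assms by (auto simp: Aut_def)
  have \<Phi>_inv: "\<Phi> (inv \<Phi> x) = x" and inv_\<Phi>: "inv \<Phi> (\<Phi> x) = x" for x
    using bij by (simp_all add: bij_is_surj surj_f_inv_f bij_is_inj)
  have "linear (inv \<Phi>)"
    by (rule linearI)
      (metis \<Phi>_inv inv_\<Phi> linear_add[OF lin], metis \<Phi>_inv inv_\<Phi> linear_scale[OF lin])
  moreover have "inv \<Phi> (br x y) = br (inv \<Phi> x) (inv \<Phi> y)" for x y
    by (metis \<Phi>_inv inv_\<Phi> hom)
  ultimately show ?thesis
    using bij by (simp add: Aut_def bij_imp_bij_inv)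
qed

lemma comp_in_Aut: "\<Phi> \<in> Aut br \<Longrightarrow> \<Psi> \<in> Aut br \<Longrightarrow> \<Phi> \<circ> \<Psi> \<in> Aut br"
  by (auto simp: Aut_def bij_comp intro: linear_compose)

text \<open>Equivalence is handled as an intertwining relation, which avoids computing the inverse
  of \<open>\<Phi>\<close>.\<close>

lemma equivalentI:
  assumes "\<Phi> \<in> Aut br" "\<And>x. \<Phi> (B *v x) = A *v \<Phi> x"
  shows "equivalent br A B"
proof -
  have "inv \<Phi> \<circ> (*v) A \<circ> \<Phi> = (*v) B"
    using assms by (simp add: fun_eq_iff Aut_def bij_def inv_f_f flip: assms(2))
  then show ?thesis
    using assms(1) unfolding equivalent_def aut_orbit_def
    by (metis (mono_tags, lifting) mem_Collect_eq matrix_of_matrix_vector_mul)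
qed

lemma equivalentE:
  assumes "equivalent br A B"
  obtains \<Phi> where "\<Phi> \<in> Aut br" "\<And>x. \<Phi> (B *v x) = A *v \<Phi> x"
proof -
  from assms obtain \<Phi> where \<Phi>: "\<Phi> \<in> Aut br" and B: "B = matrix (inv \<Phi> \<circ> (*v) A \<circ> \<Phi>)"
    by (auto simp: equivalent_def aut_orbit_def)
  have "linear \<Phi>" "bij \<Phi>" "linear (inv \<Phi>)"
    using \<Phi> inv_in_Aut[OF \<Phi>] by (auto simp: Aut_def)
  have "linear (inv \<Phi> \<circ> (*v) A \<circ> \<Phi>)"
    by (intro linear_compose \<open>linear \<Phi>\<close> \<open>linear (inv \<Phi>)\<close> matrix_vector_mul_linear)
  then have "B *v x = inv \<Phi> (A *v \<Phi> x)" for x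
    unfolding B by (simp add: matrix_works)
  then show thesis
    using that[OF \<Phi>] \<open>bij \<Phi>\<close> by (simp add: bij_is_surj surj_f_inv_f)
qed

lemma equivalent_refl: "equivalent br A A"
  by (rule equivalentI[where \<Phi> = "\<lambda>x. x"]) (simp_all add: Aut_def linear_ident bij_betw_def)

lemma equivalent_sym:
  assumes "equivalent br A B"
  shows "equivalent br B A"
proof -
  obtain \<Phi> where \<Phi>: "\<Phi> \<in> Aut br" "\<And>x. \<Phi> (B *v x) = A *v \<Phi> x"
    using equivalentE[OF assms] by metis
  then have bij: "bij \<Phi>" by (simp add: Aut_def)
  have "inv \<Phi> (A *v x) = B *v inv \<Phi> x" for x
    using \<Phi>(2)[of "inv \<Phi> x"] bij by (metis bij_inv_eq_iff)
  then show ?thesis using equivalentI[OF inv_in_Aut[OF \<Phi>(1)]] by blast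
qed

lemma equivalent_trans:
  assumes "equivalent br A B" "equivalent br B C"
  shows "equivalent br A C"
proof -
  obtain \<Phi> \<Psi> where "\<Phi> \<in> Aut br" "\<And>x. \<Phi> (B *v x) = A *v \<Phi> x"
    and "\<Psi> \<in> Aut br" "\<And>x. \<Psi> (C *v x) = B *v \<Psi> x"
    using equivalentE[OF assms(1)] equivalentE[OF assms(2)] by metis
  then show ?thesis
    by (intro equivalentI[where \<Phi> = "\<Phi> \<circ> \<Psi>"] comp_in_Aut) simp_all
qed

lemma aut_orbit_eq_iff: "aut_orbit br A = aut_orbit br B \<longleftrightarrow> equivalent br A B"
  using equivalent_refl equivalent_sym equivalent_trans
  unfolding equivalent_def by blast

lemma equivalent_J_M18_1:
  assumes "A \<in> complex_structures M18_1" "\<epsilon> = 1 \<or> \<epsilon> = - 1" "\<epsilon> * (A$3$6) > 0"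
  shows "equivalent M18_1 A (J_M18_1 \<epsilon>)"
proof -
  define J where "J = (*v) A"
  have cs: "complex_structure M18_1 J"
    using assms by (simp add: complex_structures_def J_def)
  then obtain \<eta> c d e f p q r s where c: "c \<noteq> 0" and \<eta>: "\<eta> * \<eta> = 1"
    and J6: "J (axis 6 1) = comps 0 0 c d e f" and J1: "J (axis 1 1) = comps 0 \<eta> p q r s"
    and "J (comps 0 0 0 c 0 d) = comps 0 0 0 0 (\<eta> * c) (\<eta> * e)"
    and J5: "J (comps 0 0 0 0 c e) = comps 0 0 0 (- \<eta> * c) 0 (- \<eta> * d)"
    and comm: "\<And>x. M18_1 (comps 0 0 c d e f) (J x) = J (M18_1 (comps 0 0 c d e f) x)"
    by (rule complex_structure_M18_1E) blast
  have lin: "linear J" and sq: "\<And>x. J (J x) = - x"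
    using cs by (simp_all add: complex_structure_def)
  note J_simps = linear_add[OF lin] linear_diff[OF lin] linear_neg[OF lin] linear_scale[OF lin]
  have \<epsilon>c: "\<epsilon> * c > 0"
    using assms(3) J6 by (simp add: J_def matrix_mult_axis[of A, symmetric])
  define w where "w = comps 0 0 c d e f"
  have Jw: "J w = - axis 6 1"
    unfolding w_def by (metis J6 sq)
  \<comment> \<open>The only place where the sign of \<open>c\<close> matters: scaling x1 by
    \<open>a\<close> changes \<open>c\<close> by a positive square, so \<open>\<epsilon> * c\<close>
    can be normalized to 1 but its sign cannot be changed.\<close>
  define a where "a = 1 / sqrt (\<epsilon> * c)"
  have "\<epsilon> \<noteq> 0" using assms(2) by auto
  then have a: "a \<noteq> 0" "a * a * (\<epsilon> * c) = 1"
    using \<epsilon>c c by (simp_all add: a_def)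
  \<comment> \<open>With x1 scaled by \<open>a\<close> and x2 by \<open>a * \<eta>\<close> modulo
    higher terms, the fourfold bracket x6 is scaled by \<open>a^3 (a \<eta>)\<close>.\<close>
  define l where "l = \<eta> * (a * a * a * a)"
  have \<epsilon>lc: "\<epsilon> * l * c = a * a * \<eta>"
    using a(2) by (simp add: l_def algebra_simps)
  define \<alpha> \<beta> where "\<alpha> = - \<epsilon> * l * e / (a * \<eta> * c)" and "\<beta> = (\<epsilon> * l * d - a * a * p) / (a * c)"
  define \<delta> where "\<delta> = (a * a * q + a * \<beta> * d - a * \<eta> * \<alpha> * e - \<epsilon> * l * f) / (2 * a * \<eta> * c)"
  \<comment> \<open>The coefficients of \<open>X\<close> solve \<open>[X, J X] = \<epsilon> l w\<close>; then \<open>x\<^sub>1 \<mapsto> X\<close>, \<open>x\<^sub>2 \<mapsto> J X\<close> extends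
    to an automorphism with \<open>x\<^sub>6 \<mapsto> l x\<^sub>6\<close> intertwining \<open>J\<close> with \<open>J(\<epsilon>)\<close>.\<close>
  define X where "X = a *\<^sub>R axis 1 1 + \<alpha> *\<^sub>R w + \<beta> *\<^sub>R axis 6 1 + \<delta> *\<^sub>R comps 0 0 0 0 c e"
  have JX: "J X = a *\<^sub>R comps 0 \<eta> p q r s - \<alpha> *\<^sub>R axis 6 1 + \<beta> *\<^sub>R w
      + \<delta> *\<^sub>R comps 0 0 0 (- \<eta> * c) 0 (- \<eta> * d)"
    by (simp add: X_def J_simps J1 J5 J6 Jw w_def[symmetric])
  have "\<eta> \<noteq> 0" using \<eta> by auto
  then have coeffs: "\<alpha> * (a * \<eta> * c) = - \<epsilon> * l * e" "\<beta> * (a * c) = \<epsilon> * l * d - a * a * p"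
    "\<delta> * (2 * a * \<eta> * c) = a * a * q + a * \<beta> * d - a * \<eta> * \<alpha> * e - \<epsilon> * l * f"
    using c a by (simp_all add: \<alpha>_def \<beta>_def \<delta>_def)
  \<comment> \<open>Coordinate 3 is \<open>\<epsilon>lc\<close>; coordinates 5, 4 and 6 are the
    equations for \<open>\<alpha>\<close>, \<open>\<beta>\<close> and
    \<open>\<delta>\<close>.\<close>
  have XJX: "M18_1 X (J X) = (\<epsilon> * l) *\<^sub>R w"
    unfolding JX
    by (simp add: vec6_eq_iff X_def w_def \<epsilon>lc) (use coeffs in \<open>simp add: algebra_simps\<close>)
  have ad_w: "M18_1 (J y) w = J (M18_1 y w)" for y
    using comm[of y] M18_1_commute[of "J y" w] M18_1_commute[of y w]
    by (simp add: w_def[symmetric] J_simps)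
  have "a * a * c * (\<epsilon> * l) = l" using a(2) by algebra
  then have XXw: "(\<epsilon> * l) *\<^sub>R M18_1 X (M18_1 X w) = l *\<^sub>R axis 6 1"
    by (simp add: X_def w_def vec6_eq_iff algebra_simps)
  define \<Phi> where "\<Phi> = hom_of_images X (J X)"
  have "\<Phi> \<in> Aut M18_1"
    unfolding \<Phi>_def
  proof (rule hom_of_images_in_Aut)
    show "a * \<eta> * (a * \<eta>) = a * a" using \<eta> by (simp add: algebra_simps)
    show "X $ 1 = a" "X $ 2 = 0" by (simp_all add: X_def w_def)
    show "J X $ 1 = 0" "J X $ 2 = a * \<eta>" by (simp_all add: JX w_def)
  qed (rule a(1))
  \<comment> \<open>In this form the images of x3 and x6, and of x4 and x5, are visibly paired by J,
    since ad w commutes with J.\<close>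
  have \<Phi>: "\<Phi> v = v$1 *\<^sub>R X + v$2 *\<^sub>R J X + (v$3 * \<epsilon> * l) *\<^sub>R w + (v$4 * \<epsilon> * l) *\<^sub>R M18_1 X w
     + (v$5 * \<epsilon> * l) *\<^sub>R J (M18_1 X w) + (v$6 * l) *\<^sub>R axis 6 1" for v
    unfolding \<Phi>_def hom_of_images_def XJX M18_1_linear_simps XXw ad_w
    by (simp add: algebra_simps)
  have "\<Phi> (J_M18_1 \<epsilon> *v x) = J (\<Phi> x)" for x
    unfolding \<Phi> J_M18_1_mult J_simps J6 Jw w_def[symmetric]
    using assms(2) by (elim disjE) (simp_all add: sq algebra_simps)
  then show ?thesis
    unfolding J_def by (rule equivalentI[OF \<open>\<Phi> \<in> Aut M18_1\<close>])
qed

text \<open>An intertwining automorphism sends x6 to \<open>m\<close> x6 and hence x3 to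
  \<open>- m\<close> x3. Applying it to x6 = [x1, [x1, x3]] gives
  \<open>m = - m (u1^2 + u2^2)\<close> for the image u of x1, impossible for \<open>m\<close>
  nonzero.\<close>

lemma not_equivalent_J_M18_1: "\<not> equivalent M18_1 (J_M18_1 1) (J_M18_1 (- 1))"
proof
  assume "equivalent M18_1 (J_M18_1 1) (J_M18_1 (- 1))"
  then obtain \<Phi> where "\<Phi> \<in> Aut M18_1" and comm: "\<And>x. \<Phi> (J_M18_1 (- 1) *v x) = J_M18_1 1 *v \<Phi> x"
    by (rule equivalentE) blast
  then have lin: "linear \<Phi>" and "inj \<Phi>" and hom: "\<And>x y. \<Phi> (M18_1 x y) = M18_1 (\<Phi> x) (\<Phi> y)"
    by (auto simp: Aut_def bij_is_inj)
  define u where "u = \<Phi> (axis 1 1)"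
  define m where "m = \<Phi> (axis 6 1) $ 6"
  have x6: "\<Phi> (M18_1 (axis 1 1) (M18_1 (axis 1 1) (axis 3 1))) = \<Phi> (axis 6 1)"
    "\<Phi> (M18_1 (axis 1 1) (M18_1 (axis 1 1) (M18_1 (axis 1 1) (axis 2 1)))) = \<Phi> (axis 6 1)"
    by (simp_all add: M18_1_basis)
  have \<Phi>6: "\<Phi> (axis 6 1) = m *\<^sub>R axis 6 1"
    unfolding m_def x6(2)[symmetric] hom by (simp add: vec6_eq_iff)
  have "m \<noteq> 0"
  proof
    assume "m = 0"
    then have "\<Phi> (axis 6 1) = \<Phi> 0" using \<Phi>6 linear_0[OF lin] by simp
    then show False using \<open>inj \<Phi>\<close> by (simp add: inj_eq axis_eq_0_iff)
  qed
  have "J_M18_1 (- 1) *v axis 6 1 = - axis 3 1" "J_M18_1 1 *v (m *\<^sub>R axis 6 1) = m *\<^sub>R axis 3 1"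
    by (simp_all add: J_M18_1_mult vec6_eq_iff)
  then have \<Phi>3: "\<Phi> (axis 3 1) = - m *\<^sub>R axis 3 1"
    using comm[of "axis 6 1"] by (simp add: \<Phi>6 linear_neg[OF lin]) (metis minus_minus)
  have "m *\<^sub>R axis 6 1 = M18_1 u (M18_1 u (- m *\<^sub>R axis 3 1))"
    using x6(1) unfolding hom \<Phi>3 \<Phi>6 u_def by simp
  from arg_cong[OF this, of "\<lambda>v. v $ 6"] have "m * (1 + u$1 * u$1 + u$2 * u$2) = 0"
    by (simp add: algebra_simps)
  moreover have "1 + u$1 * u$1 + u$2 * u$2 > 0"
    by (intro add_pos_nonneg) simp_all
  ultimately show False using \<open>m \<noteq> 0\<close> by simp
qed

lemma J_M18_1_in_complex_structures: "\<epsilon> \<noteq> 0 \<Longrightarrow> J_M18_1 \<epsilon> \<in> complex_structures M18_1"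
proof -
  assume "\<epsilon> \<noteq> 0"
  moreover have "J_M18_1 \<epsilon> = J_param 1 \<epsilon> 0 0 0 0 0 0 0"
    by (simp add: vec_eq_iff[of "J_M18_1 \<epsilon>"] vec6_eq_iff forall_6 J_M18_1_def J_param_def Let_def)
  ultimately show ?thesis by (simp add: J_param_in_complex_structures)
qed

section \<open>The submanifold structure\<close>

definition coords :: "real^6^6 \<Rightarrow> real^6^6" where
  "coords A = (\<chi> i j. if (i, j) \<in> {3, 4, 5, 6} \<times> {1, 6} then A$i$j else 0)"

text \<open>The sign \<open>\<eta>\<close> remains a separate argument because it is locally
  constant on the complex structures; the matrix supplies only the eight entries kept by
  \<open>coords\<close>.\<close>

definition J_of_coords :: "real \<Rightarrow> real^6^6 \<Rightarrow> real^6^6" where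
  "J_of_coords \<eta> A =
    J_param \<eta> (A$3$6) (A$4$6) (A$5$6) (A$6$6) (A$3$1) (A$4$1) (A$5$1) (A$6$1)"

lemma coords_nth: "coords A $ i $ j = (if (i, j) \<in> {3, 4, 5, 6} \<times> {1, 6} then A$i$j else 0)"
  by (simp add: coords_def)

lemma linear_coords: "linear coords"
  by (rule linearI) (simp_all add: vec_eq_iff coords_nth)

lemma dim_range_coords: "dim (range coords) = 8"
proof -
  \<comment> \<open>The eight matrix units at the retained positions; the range of
    \<open>coords\<close> is the coordinate subspace they span.\<close>
  define B :: "(real^6^6) set" where "B = (\<lambda>(i, j). axis i (axis j 1)) ` ({3, 4, 5, 6} \<times> {1, 6})"
  have "B \<subseteq> Basis"
    by (auto simp: B_def Basis_vec_def)
  have "inj_on (\<lambda>(i, j). axis i (axis j 1) :: real^6^6) ({3, 4, 5, 6} \<times> {1, 6})"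
    by (auto simp: inj_on_def axis_eq_axis)
  then have "card B = 8"
    unfolding B_def by (simp add: card_image card_cartesian_product)
  have "range coords = {A. coords A = A}"
    by (auto simp: vec_eq_iff coords_nth image_iff)
  also have "\<dots> = {A. \<forall>b\<in>Basis. b \<notin> B \<longrightarrow> A \<bullet> b = 0}"
  proof -
    have "axis i (axis j 1) \<in> B \<longleftrightarrow> (i, j) \<in> {3, 4, 5, 6} \<times> {1, 6}" for i j
      unfolding B_def by (force simp: axis_eq_axis)
    moreover have "(\<forall>b\<in>Basis. b \<notin> B \<longrightarrow> A \<bullet> b = 0) \<longleftrightarrow>
        (\<forall>i j. axis i (axis j 1) \<notin> B \<longrightarrow> A$i$j = 0)" for A
      by (auto simp: Basis_vec_def inner_axis)
    moreover have "coords A = A \<longleftrightarrow> (\<forall>i j. (i, j) \<notin> {3, 4, 5, 6} \<times> {1, 6} \<longrightarrow> A$i$j = 0)" for A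
      unfolding vec_eq_iff coords_nth by metis
    ultimately show ?thesis by simp
  qed
  also have "dim \<dots> = card B"
    by (rule dim_substandard[OF \<open>B \<subseteq> Basis\<close>])
  finally show ?thesis using \<open>card B = 8\<close> by simp
qed

lemma smooth_on_J_of_coords: "smooth_on {A. A$3$6 \<noteq> 0} (J_of_coords \<eta>)"
proof -
  let ?W = "{A :: real^6^6. A$3$6 \<noteq> 0}"
  have W: "open ?W"
    by (intro open_Collect_neq continuous_intros)
  have entry: "smooth_on ?W (\<lambda>A. A$i$j)" for i j
    by (rule smooth_on_linear[OF W]) (rule linearI, simp_all)
  note intros = smooth_on_add smooth_on_diff smooth_on_minus smooth_on_mult smooth_on_divide
    smooth_on_const entry W
  show ?thesis
  proof (rule smooth_on_matrix[OF W])
    fix i j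
    show "smooth_on ?W (\<lambda>A. J_of_coords \<eta> A $ i $ j)"
      unfolding J_of_coords_def J_param_def Let_def
      using exhaust_6[of i] exhaust_6[of j]
      by (elim disjE; simp only: vector_6; intro intros; simp)
  qed
qed

lemma submanifold_complex_structures_M18_1: "submanifold 8 (complex_structures M18_1)"
  unfolding dim_range_coords[symmetric]
proof (rule submanifold_graph[OF linear_coords])
  show "coords (coords A) = coords A" for A
    by (simp add: vec_eq_iff coords_nth)
next
  fix A assume A: "A \<in> complex_structures M18_1"
  define \<eta> where "\<eta> = A$2$1"
  note A_props = complex_structures_M18_1_J_param[OF A]
  \<comment> \<open>On \<open>?U\<close> the entry (2,1) of a complex structure, being 1 or -1, must
    equal \<open>\<eta>\<close>. The sign condition is left out of \<open>?W\<close> because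
    \<open>coords\<close> erases that entry, while membership in \<open>?W\<close> must be invariant
    under \<open>coords\<close>.\<close>
  let ?W = "{A :: real^6^6. A$3$6 \<noteq> 0}" and ?U = "{A :: real^6^6. A$3$6 \<noteq> 0} \<inter> {A. \<eta> * A$2$1 > 0}"
  let ?G = "J_of_coords \<eta>"
  have \<eta>: "\<eta> * \<eta> = 1" using A_props(2) by (simp add: \<eta>_def)
  have "open ?W"
    by (intro open_Collect_neq continuous_intros)
  moreover have "open {A :: real^6^6. \<eta> * A$2$1 > 0}"
    by (intro open_Collect_less continuous_intros)
  moreover have "?G (coords B) = ?G B" for B
    by (simp add: J_of_coords_def coords_nth)
  moreover have "coords (?G B) = coords B" for B
  proof -
    have "coords (?G B) $ i $ j = coords B $ i $ j" for i j
      using exhaust_6[of i] exhaust_6[of j]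
      by (elim disjE) (simp_all add: coords_nth J_of_coords_def J_param_def Let_def)
    then show ?thesis by (simp add: vec_eq_iff)
  qed
  moreover have "B \<in> complex_structures M18_1 \<longleftrightarrow> ?G B = B" if "B \<in> ?U" for B
  proof
    assume B: "B \<in> complex_structures M18_1"
    then have "B$2$1 = 1 \<or> B$2$1 = - 1"
      using complex_structures_M18_1_J_param(2)[OF B] by (simp add: square_eq_1_iff)
    moreover have "\<eta> = 1 \<or> \<eta> = - 1"
      using \<eta> by (simp add: square_eq_1_iff)
    ultimately have "B$2$1 = \<eta>" using that by auto
    then show "?G B = B"
      using complex_structures_M18_1_J_param(3)[OF B] by (simp add: J_of_coords_def)
  next
    assume "?G B = B"
    moreover have "?G B \<in> complex_structures M18_1"
      unfolding J_of_coords_def using that \<eta> by (intro J_param_in_complex_structures) auto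
    ultimately show "B \<in> complex_structures M18_1" by simp
  qed
  then have "complex_structures M18_1 \<inter> ?U = {B \<in> ?U. ?G B = B}" by blast
  moreover have "A \<in> ?U" using A_props \<eta> by (simp add: \<eta>_def)
  ultimately show "\<exists>U W G. A \<in> U \<and> open U \<and> U \<subseteq> W \<and> open W \<and> smooth_on W G \<and>
      (\<forall>x. coords x \<in> W \<longleftrightarrow> x \<in> W) \<and> (\<forall>x\<in>W. G (coords x) = G x \<and> coords (G x) = coords x) \<and>
      complex_structures M18_1 \<inter> U = {x \<in> U. G x = x}"
    by (intro exI[of _ ?U] exI[of _ ?W] exI[of _ ?G])
      (auto simp: smooth_on_J_of_coords coords_nth intro: open_Int)
qed

theorem mainTheorem10:
  shows "J_M18_1 1 \<in> complex_structures M18_1 \<and> J_M18_1 (-1) \<in> complex_structures M18_1 \<and>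
    (\<forall>J \<in> complex_structures M18_1.
       equivalent M18_1 J (J_M18_1 1) \<or> equivalent M18_1 J (J_M18_1 (-1))) \<and>
    \<not> equivalent M18_1 (J_M18_1 1) (J_M18_1 (-1)) \<and>
    card (aut_orbit M18_1 ` complex_structures M18_1) = 2 \<and>
    submanifold 8 (complex_structures M18_1)"
proof -
  let ?X = "complex_structures M18_1"
  have mem: "J_M18_1 1 \<in> ?X" "J_M18_1 (- 1) \<in> ?X"
    by (simp_all add: J_M18_1_in_complex_structures)
  \<comment> \<open>The sign of the nonzero entry (3,6) selects \<open>\<epsilon>\<close>.\<close>
  have normal_form: "equivalent M18_1 J (J_M18_1 1) \<or> equivalent M18_1 J (J_M18_1 (- 1))"
    if "J \<in> ?X" for J
    using equivalent_J_M18_1[OF that, of 1] equivalent_J_M18_1[OF that, of "- 1"]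
      complex_structures_M18_1_J_param(1)[OF that] by (simp add: neq_iff) blast
  then have "aut_orbit M18_1 ` ?X = {aut_orbit M18_1 (J_M18_1 1), aut_orbit M18_1 (J_M18_1 (- 1))}"
    using mem unfolding aut_orbit_eq_iff[symmetric] by blast
  then have "card (aut_orbit M18_1 ` ?X) = 2"
    using not_equivalent_J_M18_1 by (simp add: aut_orbit_eq_iff)
  then show ?thesis
    using mem normal_form not_equivalent_J_M18_1 submanifold_complex_structures_M18_1 by blast
qed

end
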